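(* Let $k$ be a field and let $R$ be an almost PI $k$-algebra (not necessarily affine). Then $R$ is prime.
   Context: All algebras are associative with 1. PI means satisfying a (nontrivial) polynomial identity over $k$. A $k$-algebra $R$ is almost PI if $R$ is not PI and $R/I$ is PI for every nonzero two-sided ideal $I$ of $R$. Affine means finitely generated as a $k$-algebra. *)

theory Defs
  imports "HOL-Algebra.QuotRing" "HOL-Algebra.Ideal_Product" "HOL-Algebra.Module"
begin

text \<open>
  Associative unital algebras over a field. The locale \<^locale>\<open>algebra\<close> of the library requires
  the algebra to be commutative, so the noncommutative notion is introduced here. The zero
  algebra is allowed.
\<close>

locale assoc_algebra = K: field K + R: ring R + module K R for K and R (structure) +
  assumes smult_mult_left:
      "\<lbrakk>a \<in> carrier K; x \<in> carrier R; y \<in> carrier R\<rbrakk> \<Longrightarrow> (a \<odot> x) \<otimes> y = a \<odot> (x \<otimes> y)"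
    and smult_mult_right:
      "\<lbrakk>a \<in> carrier K; x \<in> carrier R; y \<in> carrier R\<rbrakk> \<Longrightarrow> x \<otimes> (a \<odot> y) = a \<odot> (x \<otimes> y)"

text \<open>
  The free algebra on noncommuting indeterminates \<open>X\<^sub>0, X\<^sub>1, \<dots>\<close>: a word in the indeterminates is
  a list of indices, and a polynomial is a finitely supported coefficient function on words.
  Finite support means that every polynomial involves only finitely many indeterminates.
\<close>

definition nc_support :: "('k, 'c) ring_scheme \<Rightarrow> (nat list \<Rightarrow> 'k) \<Rightarrow> nat list set" where
  "nc_support K f = {w. f w \<noteq> \<zero>\<^bsub>K\<^esub>}"

definition nc_polys :: "('k, 'c) ring_scheme \<Rightarrow> (nat list \<Rightarrow> 'k) set" where
  "nc_polys K = {f. range f \<subseteq> carrier K \<and> finite (nc_support K f)}"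

definition word_eval :: "('r, 'd) ring_scheme \<Rightarrow> (nat \<Rightarrow> 'r) \<Rightarrow> nat list \<Rightarrow> 'r" where
  "word_eval R x w = foldr (\<lambda>i y. x i \<otimes>\<^bsub>R\<^esub> y) w \<one>\<^bsub>R\<^esub>"

definition nc_eval ::
  "('k, 'c) ring_scheme \<Rightarrow> ('k, 'r, 'd) module_scheme \<Rightarrow> (nat list \<Rightarrow> 'k) \<Rightarrow> (nat \<Rightarrow> 'r) \<Rightarrow> 'r" where
  "nc_eval K R f x = (\<Oplus>\<^bsub>R\<^esub>w\<in>nc_support K f. f w \<odot>\<^bsub>R\<^esub> word_eval R x w)"

definition polynomial_identity ::
  "('k, 'c) ring_scheme \<Rightarrow> ('k, 'r, 'd) module_scheme \<Rightarrow> (nat list \<Rightarrow> 'k) \<Rightarrow> bool" where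
  "polynomial_identity K R f \<longleftrightarrow>
     f \<in> nc_polys K \<and> (\<forall>x. range x \<subseteq> carrier R \<longrightarrow> nc_eval K R f x = \<zero>\<^bsub>R\<^esub>)"

definition PI :: "('k, 'c) ring_scheme \<Rightarrow> ('k, 'r, 'd) module_scheme \<Rightarrow> bool" where
  "PI K R \<longleftrightarrow> (\<exists>f. polynomial_identity K R f \<and> f \<noteq> (\<lambda>_. \<zero>\<^bsub>K\<^esub>))"

text \<open>
  The quotient algebra \<open>R/I\<close>: the library's quotient ring together with the induced scalar
  multiplication, given on cosets in the same way as \<^const>\<open>rcoset_mult\<close>.
\<close>

definition rcoset_smult ::
  "('k, 'r, 'd) module_scheme \<Rightarrow> 'r set \<Rightarrow> 'k \<Rightarrow> 'r set \<Rightarrow> 'r set" where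
  "rcoset_smult R I a X = (\<Union>x\<in>X. I +>\<^bsub>R\<^esub> (a \<odot>\<^bsub>R\<^esub> x))"

definition quotient_algebra ::
  "('k, 'r, 'd) module_scheme \<Rightarrow> 'r set \<Rightarrow> ('k, 'r set) module" where
  "quotient_algebra R I = ring.extend (R Quot I) (module.fields (rcoset_smult R I))"

definition almost_PI :: "('k, 'c) ring_scheme \<Rightarrow> ('k, 'r, 'd) module_scheme \<Rightarrow> bool" where
  "almost_PI K R \<longleftrightarrow>
     \<not> PI K R \<and> (\<forall>I. ideal I R \<and> I \<noteq> {\<zero>\<^bsub>R\<^esub>} \<longrightarrow> PI K (quotient_algebra R I))"

text \<open>
  Primeness in the noncommutative sense. The library's \<^locale>\<open>primeideal\<close> is elementwise and
  restricted to commutative rings.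
\<close>

definition prime_ring :: "('r, 'd) ring_scheme \<Rightarrow> bool" where
  "prime_ring R \<longleftrightarrow> ring R \<and> carrier R \<noteq> {\<zero>\<^bsub>R\<^esub>} \<and>
     (\<forall>I J. ideal I R \<and> ideal J R \<and> I \<cdot>\<^bsub>R\<^esub> J = {\<zero>\<^bsub>R\<^esub>} \<longrightarrow> I = {\<zero>\<^bsub>R\<^esub>} \<or> J = {\<zero>\<^bsub>R\<^esub>})"

lemma quotient_algebra_simps [simp]:
  "carrier (quotient_algebra R I) = carrier (R Quot I)"
  "mult (quotient_algebra R I) = mult (R Quot I)"
  "one (quotient_algebra R I) = one (R Quot I)"
  "zero (quotient_algebra R I) = zero (R Quot I)"
  "add (quotient_algebra R I) = add (R Quot I)"
  "smult (quotient_algebra R I) = rcoset_smult R I"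
  by (simp_all add: quotient_algebra_def ring.defs module.defs)

context assoc_algebra
begin

lemma smult_closed_ideal:
  assumes "ideal I R" "a \<in> carrier K" "x \<in> I"
  shows "a \<odot> x \<in> I"
proof -
  interpret I: ideal I R by fact
  have x: "x \<in> carrier R" using assms I.Icarr by blast
  have "a \<odot> x = (a \<odot> \<one>) \<otimes> x"
    using assms x by (simp add: smult_mult_left)
  then show ?thesis using assms x by (simp add: I.I_l_closed)
qed

lemma rcoset_smult_coset:
  assumes "ideal I R" "a \<in> carrier K" "x \<in> carrier R"
  shows "rcoset_smult R I a (I +> x) = I +> (a \<odot> x)"
proof -
  interpret I: ideal I R by fact
  have *: "I +> (a \<odot> y) = I +> (a \<odot> x)" if "y \<in> I +> x" for y
  proof -
    from that obtain h where h: "h \<in> I" "y = h \<oplus> x"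
      by (auto simp: a_r_coset_def')
    have "a \<odot> y = a \<odot> h \<oplus> a \<odot> x"
      using h assms I.Icarr by (simp add: smult_r_distr)
    moreover have "a \<odot> h \<in> I" using smult_closed_ideal assms h by blast
    ultimately have "a \<odot> y \<in> I +> (a \<odot> x)"
      by (auto simp: a_r_coset_def')
    then show ?thesis
      using I.a_repr_independence' assms by (metis smult_closed)
  qed
  moreover have "x \<in> I +> x" using assms by (simp add: I.a_rcos_self)
  ultimately show ?thesis unfolding rcoset_smult_def by blast
qed

lemma quotient_assoc_algebra:
  assumes "ideal I R"
  shows "assoc_algebra K (quotient_algebra R I)"
proof -
  interpret I: ideal I R by fact
  interpret Q: ring "R Quot I" by (rule I.quotient_is_ring)
  let ?Q = "quotient_algebra R I"
  have coset: "\<exists>x\<in>carrier R. X = I +> x" if "X \<in> carrier (R Quot I)" for X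
    using that by (auto simp: FactRing_simps)
  have in_Q: "I +> x \<in> carrier (R Quot I)" if "x \<in> carrier R" for x
    using that by (auto simp: FactRing_simps)
  have ops: "(I +> x) \<oplus>\<^bsub>R Quot I\<^esub> (I +> y) = I +> (x \<oplus> y)"
            "(I +> x) \<otimes>\<^bsub>R Quot I\<^esub> (I +> y) = I +> (x \<otimes> y)"
    if "x \<in> carrier R" "y \<in> carrier R" for x y
    using that by (simp_all add: FactRing_def I.a_rcos_sum I.rcoset_mult_add)
  have ring: "ring ?Q"
  proof (rule ringI)
    show "abelian_group ?Q"
    proof (rule abelian_groupI)
      fix x assume "x \<in> carrier ?Q"
      then show "\<exists>y\<in>carrier ?Q. y \<oplus>\<^bsub>?Q\<^esub> x = \<zero>\<^bsub>?Q\<^esub>"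
        using Q.a_inv_closed Q.l_neg by auto
    qed (simp_all add: Q.a_assoc Q.a_comm Q.a_lcomm)
    show "Group.monoid ?Q"
      by (rule monoidI) (auto simp: Q.m_assoc)
  qed (auto simp: Q.l_distr Q.r_distr)
  have mod: "module K ?Q"
    using coset
    by (intro moduleI K.is_cring ring.is_abelian_group ring)
       (auto dest!: coset simp: ops in_Q rcoset_smult_coset[OF assms]
          smult_l_distr smult_r_distr smult_assoc1)
  show ?thesis
    by (intro assoc_algebra.intro assoc_algebra_axioms.intro mod K.field_axioms ring)
       (auto dest!: coset simp: ops in_Q rcoset_smult_coset[OF assms]
          smult_mult_left smult_mult_right)
qed

end

end

theory Submission
  imports Defs "HOL-Algebra.UnivPoly"
begin

text \<open>
  If nonzero ideals \<open>I\<close>, \<open>J\<close> satisfy \<open>I J = 0\<close>, take nonzero identities \<open>f\<close> of \<open>R/I\<close> and \<open>g\<close> of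
  \<open>R/J\<close>. On \<open>R\<close> they take values in \<open>I\<close> and \<open>J\<close>, so \<open>f X\<^sub>n g\<close> vanishes identically on \<open>R\<close>. Choosing
  \<open>X\<^sub>n\<close> not to occur in \<open>f\<close> makes the factorisation \<open>u X\<^sub>n v\<close> of each word unique, so no cancellation
  occurs, this product is nonzero, and \<open>R\<close> is PI.
\<close>

text \<open>The product set is the disjoint union of its fibres over \<open>A\<close>, and each
  fibre is a bijective copy of \<open>B\<close>.\<close>

lemma (in abelian_monoid) finsum_cartesian_product:
  assumes "finite A" "finite B" "\<And>a b. a \<in> A \<Longrightarrow> b \<in> B \<Longrightarrow> g a b \<in> carrier G"
  shows "(\<Oplus>p\<in>A \<times> B. g (fst p) (snd p)) = (\<Oplus>a\<in>A. \<Oplus>b\<in>B. g a b)"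
proof -
  have "A \<times> B = (\<Union>a\<in>A. Pair a ` B)" by auto
  then have "(\<Oplus>p\<in>A \<times> B. g (fst p) (snd p)) = (\<Oplus>a\<in>A. \<Oplus>p\<in>Pair a ` B. g (fst p) (snd p))"
    using assms
    by (auto intro!: add.finprod_UN_disjoint simp: pairwise_def disjnt_def)
  also have "\<dots> = (\<Oplus>a\<in>A. \<Oplus>b\<in>B. g a b)"
  proof (rule finsum_cong')
    show "(\<Oplus>p\<in>Pair a ` B. g (fst p) (snd p)) = (\<Oplus>b\<in>B. g a b)" if "a \<in> A" for a
      using assms that by (subst finsum_reindex) (auto simp: inj_on_def)
  qed (use assms in \<open>auto intro!: finsum_closed\<close>)
  finally show ?thesis .
qed

lemma (in ring) word_eval_closed [simp]:
  "range x \<subseteq> carrier R \<Longrightarrow> word_eval R x w \<in> carrier R"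
  by (induction w) (auto simp: word_eval_def)

lemma (in ring) word_eval_append:
  "range x \<subseteq> carrier R \<Longrightarrow> word_eval R x (u @ v) = word_eval R x u \<otimes> word_eval R x v"
proof (induction u)
  case Nil
  then show ?case using word_eval_closed by (simp add: word_eval_def)
next
  case (Cons i u)
  have "x i \<in> carrier R" using Cons.prems by auto
  then show ?case
    using Cons word_eval_closed[of x] by (simp add: word_eval_def m_assoc)
qed

lemma word_eval_Cons: "word_eval R x (i # w) = x i \<otimes>\<^bsub>R\<^esub> word_eval R x w"
  by (simp add: word_eval_def)

lemma nc_polys_closed: "f \<in> nc_polys K \<Longrightarrow> f w \<in> carrier K"
  by (auto simp: nc_polys_def)

lemma nc_polys_finite: "f \<in> nc_polys K \<Longrightarrow> finite (nc_support K f)"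
  by (simp add: nc_polys_def)

lemma nc_support_eq_empty_iff: "nc_support K f = {} \<longleftrightarrow> f = (\<lambda>_. \<zero>\<^bsub>K\<^esub>)"
  by (auto simp: nc_support_def)

context assoc_algebra
begin

lemma nc_eval_closed [simp]:
  assumes "f \<in> nc_polys K" "range x \<subseteq> carrier R"
  shows "nc_eval K R f x \<in> carrier R"
  using assms unfolding nc_eval_def
  by (intro R.finsum_closed) (auto intro: nc_polys_closed)

lemma ring_hom_word_eval:
  assumes "ring_hom_ring R S h" "range x \<subseteq> carrier R"
  shows "word_eval S (h \<circ> x) w = h (word_eval R x w)"
proof (induction w)
  case Nil
  interpret ring_hom_ring R S h by fact
  show ?case by (simp add: word_eval_def)
next
  case (Cons i w)
  interpret ring_hom_ring R S h by fact
  have "x i \<in> carrier R" using assms by auto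
  then show ?case using Cons assms by (simp add: word_eval_Cons)
qed

text \<open>Both evaluations sum over the same words, since the support depends only on the
  coefficients in \<open>K\<close>. So \<open>h\<close> can be moved through the sum, the scalars
  and the words in turn.\<close>

lemma ring_hom_nc_eval:
  assumes h: "ring_hom_ring R S h"
    and smult: "\<And>a y. a \<in> carrier K \<Longrightarrow> y \<in> carrier R \<Longrightarrow> h (a \<odot> y) = a \<odot>\<^bsub>S\<^esub> h y"
    and f: "f \<in> nc_polys K" and x: "range x \<subseteq> carrier R"
  shows "nc_eval K S f (h \<circ> x) = h (nc_eval K R f x)"
proof -
  interpret ring_hom_ring R S h by fact
  have "h (nc_eval K R f x) = (\<Oplus>\<^bsub>S\<^esub>w\<in>nc_support K f. h (f w \<odot> word_eval R x w))"
    unfolding nc_eval_def using f x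
    by (subst hom_finsum) (auto simp: nc_polys_closed o_def)
  also have "\<dots> = nc_eval K S f (h \<circ> x)"
    unfolding nc_eval_def using f x
    by (intro S.finsum_cong')
       (auto simp: smult[symmetric] nc_polys_closed ring_hom_word_eval[OF h])
  finally show ?thesis ..
qed

lemma nc_eval_in_ideal:
  assumes I: "ideal I R" and f: "polynomial_identity K (quotient_algebra R I) f"
    and x: "range x \<subseteq> carrier R"
  shows "nc_eval K R f x \<in> I"
proof -
  interpret I: ideal I R by fact
  interpret Q: assoc_algebra K "quotient_algebra R I"
    by (rule quotient_assoc_algebra[OF I])
  have hom: "ring_hom_ring R (quotient_algebra R I) ((+>) I)"
    using I.rcos_ring_hom
    by (intro ring_hom_ringI2 R.ring_axioms Q.R.ring_axioms) (simp add: ring_hom_def)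
  have poly: "f \<in> nc_polys K" using f by (simp add: polynomial_identity_def)
  have "range ((+>) I \<circ> x) \<subseteq> carrier (quotient_algebra R I)"
    using x ring_hom_closed[OF I.rcos_ring_hom] by auto
  \<comment> \<open>The zero of the quotient is the coset \<open>I\<close> itself, so a value whose
    coset is zero lies in \<open>I\<close>.\<close>
  then have "nc_eval K (quotient_algebra R I) f ((+>) I \<circ> x) = I"
    using f by (simp add: polynomial_identity_def FactRing_def)
  moreover have "nc_eval K (quotient_algebra R I) f ((+>) I \<circ> x) = I +> nc_eval K R f x"
    using poly x by (intro ring_hom_nc_eval[OF hom]) (simp_all add: rcoset_smult_coset[OF I])
  ultimately show ?thesis
    using I.a_rcos_self[of "nc_eval K R f x"] poly x by simp
qed

text \<open>With a separating letter every coefficient of the product is a single product of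
  coefficients, so no ordering of words is needed to see that it is nonzero.\<close>

lemma separated_product:
  assumes f: "f \<in> nc_polys K" "f \<noteq> (\<lambda>_. \<zero>\<^bsub>K\<^esub>)" and g: "g \<in> nc_polys K" "g \<noteq> (\<lambda>_. \<zero>\<^bsub>K\<^esub>)"
  obtains h n where "h \<in> nc_polys K" "h \<noteq> (\<lambda>_. \<zero>\<^bsub>K\<^esub>)"
    "\<And>x. range x \<subseteq> carrier R \<Longrightarrow>
       nc_eval K R h x = nc_eval K R f x \<otimes> (x n \<otimes> nc_eval K R g x)"
proof -
  let ?S = "nc_support K f" and ?T = "nc_support K g"
  have fin: "finite ?S" "finite ?T" using f g by (simp_all add: nc_polys_finite)
  obtain n where n: "n \<notin> (\<Union>u\<in>?S. set u)"
    using ex_new_if_finite[of "\<Union>u\<in>?S. set u"] fin by auto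
  define \<phi> where "\<phi> = (\<lambda>p::nat list \<times> nat list. fst p @ n # snd p)"
  have inj: "inj_on \<phi> (?S \<times> ?T)"
  proof (rule inj_onI)
    fix p q assume pq: "p \<in> ?S \<times> ?T" "q \<in> ?S \<times> ?T" "\<phi> p = \<phi> q"
    then have "n \<notin> set (fst p)" "n \<notin> set (fst q)" using n by auto
    \<comment> \<open>The separator is the first \<open>n\<close> in the word, even if the right
      factor contains further ones. Cutting there recovers the left factor, and cancelling it
      together with \<open>n\<close> recovers the right one.\<close>
    then have "takeWhile (\<lambda>i. i \<noteq> n) (\<phi> p) = fst p" "takeWhile (\<lambda>i. i \<noteq> n) (\<phi> q) = fst q"
      by (auto simp: \<phi>_def takeWhile_append)
    then show "p = q"
      using pq(3) by (simp add: \<phi>_def prod_eq_iff)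
  qed
  \<comment> \<open>As \<open>\<phi>\<close> is injective, a word in its image determines its pair
    of factors; all other words get coefficient zero.\<close>
  define h where "h w = (if w \<in> \<phi> ` (?S \<times> ?T)
     then (case inv_into (?S \<times> ?T) \<phi> w of (u, v) \<Rightarrow> f u \<otimes>\<^bsub>K\<^esub> g v) else \<zero>\<^bsub>K\<^esub>)" for w
  have h_\<phi>: "h (\<phi> p) = f (fst p) \<otimes>\<^bsub>K\<^esub> g (snd p)" if "p \<in> ?S \<times> ?T" for p
    using that inj by (simp add: h_def case_prod_unfold)
  \<comment> \<open>A field has no zero divisors.\<close>
  have nonzero: "h (\<phi> p) \<noteq> \<zero>\<^bsub>K\<^esub>" if "p \<in> ?S \<times> ?T" for p
    using that h_\<phi>[OF that] nc_polys_closed[OF f(1)] nc_polys_closed[OF g(1)]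
    by (auto simp: nc_support_def K.integral_iff)
  have supp: "nc_support K h = \<phi> ` (?S \<times> ?T)"
    using nonzero by (auto simp: nc_support_def[of K h] h_def split: if_splits)
  have h: "h \<in> nc_polys K"
    using fin supp nc_polys_closed[OF f(1)] nc_polys_closed[OF g(1)]
    by (auto simp: nc_polys_def h_def case_prod_unfold)
  have "h \<noteq> (\<lambda>_. \<zero>\<^bsub>K\<^esub>)"
    using f(2) g(2) supp by (simp flip: nc_support_eq_empty_iff)
  moreover have "nc_eval K R h x = nc_eval K R f x \<otimes> (x n \<otimes> nc_eval K R g x)"
    if x: "range x \<subseteq> carrier R" for x
  proof -
    \<comment> \<open>Putting \<open>x n\<close> into the right factor makes each summand a product
      of a term in \<open>u\<close> and a term in \<open>v\<close>, so the double sum factors by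
      distributivity; \<open>x n\<close> is taken out at the end.\<close>
    let ?a = "\<lambda>u. f u \<odot> word_eval R x u" and ?b = "\<lambda>v. x n \<otimes> (g v \<odot> word_eval R x v)"
    have xn: "x n \<in> carrier R" using x by auto
    note closed = nc_polys_closed[OF f(1)] nc_polys_closed[OF g(1)] xn R.word_eval_closed[OF x]
    have "nc_eval K R h x = (\<Oplus>p\<in>?S \<times> ?T. h (\<phi> p) \<odot> word_eval R x (\<phi> p))"
      unfolding nc_eval_def supp using h x
      by (intro R.finsum_reindex inj) (auto simp: nc_polys_closed)
    also have "\<dots> = (\<Oplus>p\<in>?S \<times> ?T. ?a (fst p) \<otimes> ?b (snd p))"
    proof (intro R.finsum_cong' refl)
      fix p assume p: "p \<in> ?S \<times> ?T"
      \<comment> \<open>The coefficients are commuted into the order in which the two scalars are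
        nested once pulled out of the product.\<close>
      have "h (\<phi> p) = g (snd p) \<otimes>\<^bsub>K\<^esub> f (fst p)"
        using h_\<phi>[OF p] closed by (simp add: K.m_comm)
      moreover have "word_eval R x (\<phi> p) = word_eval R x (fst p) \<otimes> (x n \<otimes> word_eval R x (snd p))"
        by (simp add: \<phi>_def R.word_eval_append x word_eval_Cons)
      ultimately show "h (\<phi> p) \<odot> word_eval R x (\<phi> p) = ?a (fst p) \<otimes> ?b (snd p)"
        using closed by (simp add: smult_mult_left smult_mult_right smult_assoc1)
    qed (use closed in auto)
    also have "\<dots> = (\<Oplus>u\<in>?S. \<Oplus>v\<in>?T. ?a u \<otimes> ?b v)"
      using fin closed
      by (intro R.finsum_cartesian_product[where g = "\<lambda>u v. ?a u \<otimes> ?b v"]) auto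
    also have "\<dots> = (\<Oplus>u\<in>?S. ?a u \<otimes> (\<Oplus>v\<in>?T. ?b v))"
      using fin closed
      by (intro R.finsum_cong') (auto intro!: R.finsum_rdistr[symmetric] R.finsum_closed)
    also have "\<dots> = (\<Oplus>u\<in>?S. ?a u) \<otimes> (\<Oplus>v\<in>?T. ?b v)"
      using fin closed by (intro R.finsum_ldistr[symmetric]) (auto intro!: R.finsum_closed)
    also have "(\<Oplus>v\<in>?T. ?b v) = x n \<otimes> (\<Oplus>v\<in>?T. g v \<odot> word_eval R x v)"
      using fin closed by (intro R.finsum_rdistr[symmetric]) auto
    finally show ?thesis by (simp add: nc_eval_def)
  qed
  ultimately show thesis using h that by blast
qed

text \<open>The constant polynomial 1 is a nonzero identity here. This yields the requirement in
  \<open>prime_ring\<close> that the ring be nonzero.\<close>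

lemma PI_zero_ring:
  assumes "carrier R = {\<zero>}"
  shows "PI K R"
proof -
  define f where "f = (\<lambda>_::nat list. \<zero>\<^bsub>K\<^esub>)([] := \<one>\<^bsub>K\<^esub>)"
  have "nc_support K f = {[]}" by (auto simp: nc_support_def f_def)
  then have f: "f \<in> nc_polys K" by (auto simp: nc_polys_def f_def)
  have "f [] \<noteq> \<zero>\<^bsub>K\<^esub>" by (simp add: f_def)
  moreover have "polynomial_identity K R f"
    using nc_eval_closed[OF f] assms f by (simp add: polynomial_identity_def)
  ultimately show ?thesis unfolding PI_def by metis
qed

lemma PI_if_ideal_prod_zero:
  assumes I: "ideal I R" "PI K (quotient_algebra R I)"
    and J: "ideal J R" "PI K (quotient_algebra R J)"
    and IJ: "I \<cdot> J = {\<zero>}"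
  shows "PI K R"
proof -
  interpret J: ideal J R by fact
  obtain f where f: "polynomial_identity K (quotient_algebra R I) f" "f \<noteq> (\<lambda>_. \<zero>\<^bsub>K\<^esub>)"
    using I(2) by (auto simp: PI_def)
  obtain g where g: "polynomial_identity K (quotient_algebra R J) g" "g \<noteq> (\<lambda>_. \<zero>\<^bsub>K\<^esub>)"
    using J(2) by (auto simp: PI_def)
  have "f \<in> nc_polys K" "g \<in> nc_polys K"
    using f g by (simp_all add: polynomial_identity_def)
  then obtain h n where h: "h \<in> nc_polys K" "h \<noteq> (\<lambda>_. \<zero>\<^bsub>K\<^esub>)"
    and eval: "\<And>x. range x \<subseteq> carrier R \<Longrightarrow>
      nc_eval K R h x = nc_eval K R f x \<otimes> (x n \<otimes> nc_eval K R g x)"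
    using separated_product f(2) g(2) by metis
  have "nc_eval K R h x = \<zero>" if x: "range x \<subseteq> carrier R" for x
  proof -
    \<comment> \<open>\<open>J\<close> absorbs the separator from the left, so the whole value is a
      product of an element of \<open>I\<close> and an element of \<open>J\<close>.\<close>
    have "x n \<otimes> nc_eval K R g x \<in> J"
      using x nc_eval_in_ideal[OF J(1) g(1) x] by (auto intro: J.I_l_closed)
    then have "nc_eval K R h x \<in> I \<cdot> J"
      using nc_eval_in_ideal[OF I(1) f(1) x] by (simp add: eval x ideal_prod.prod)
    then show ?thesis using IJ by simp
  qed
  then show ?thesis using h by (auto simp: PI_def polynomial_identity_def)
qed

end

theorem theorem1p1:
  fixes K :: "('k, 'c) ring_scheme" and R :: "('k, 'r, 'd) module_scheme"
  assumes "assoc_algebra K R" and "almost_PI K R"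
  shows "prime_ring R"
proof -
  interpret assoc_algebra K R by fact
  \<comment> \<open>Nonzero ideals with zero product would both have PI quotients, which would make
    \<open>R\<close> itself PI.\<close>
  show ?thesis
    using assms(2) PI_zero_ring PI_if_ideal_prod_zero R.ring_axioms
    unfolding prime_ring_def almost_PI_def by blast
qed

end
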